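(* Let $\{E_i:i\in I\}$ be any family of elementary spaces. Then the free precompact Boolean group $\mathit{FPB}(\bigoplus_{i\in I}E_i)$ of the topological sum $\bigoplus_{i\in I}E_i$ contains no infinite compact subsets.
   Context: A space is elementary if it is homeomorphic to a subspace of the form $\mathbb{N}\cup\{p\}$ of the Stone–Čech compactification $\beta\mathbb{N}$ of the discrete space $\mathbb{N}$, where $p\in\beta\mathbb{N}\setminus\mathbb{N}$; equivalently, it is a countably infinite space $E$ with a single non-isolated point $x$ such that the trace of the filter of neighbourhoods of $x$ on the discrete part $E\setminus\{x\}$ is an ultrafilter on $E\setminus\{x\}$. $\bigoplus_{i\in I}E_i$ denotes the topological sum (disjoint union topology). A Boolean group is a group in which $g+g=0$ for every element $g$. A topological group is precompact if it is (topologically isomorphic to) a subgroup of some compact (Hausdorff) group. For a topological space $X$, the free precompact Boolean group $\mathit{FPB}(X)$ is the free object over $X$ in the class of precompact Boolean topological groups: a precompact Boolean group together with a continuous map $\eta:X\to\mathit{FPB}(X)$ such that for every continuous map $\varphi:X\to H$ to a precompact Boolean group $H$ there is a unique continuous homomorphism $\Phi:\mathit{FPB}(X)\to H$ with $\Phi\circ\eta=\varphi$. *)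

theory Defs
  imports "HOL-Analysis.Analysis" "HOL-Algebra.FiniteProduct" "HOL-Algebra.Coset"
begin

section \<open>Elementary spaces\<close>

definition ultrafilter :: "'a filter \<Rightarrow> bool" where
  "ultrafilter F \<longleftrightarrow> F \<noteq> bot \<and> (\<forall>P. eventually P F \<or> eventually (\<lambda>x. \<not> P x) F)"

text \<open>The Stone--Cech compactification of the discrete space of natural numbers, in its standard
  model: the points are the ultrafilters, the sets of all ultrafilters containing a given set
  form a base, and \<open>n\<close> is identified with \<open>principal {n}\<close>.\<close>

definition beta_nat :: "nat filter topology" where
  "beta_nat = topology_generated_by (range (\<lambda>A. {F. ultrafilter F \<and> eventually (\<lambda>n. n \<in> A) F}))"

definition nat_points :: "nat filter set" where
  "nat_points = range (\<lambda>n. principal {n})"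

definition elementary_space :: "'a topology \<Rightarrow> bool" where
  "elementary_space X \<longleftrightarrow>
     (\<exists>p \<in> topspace beta_nat - nat_points.
        X homeomorphic_space subtopology beta_nat (nat_points \<union> {p}))"

lemma ultrafilter_eq_principal:
  assumes "ultrafilter F" "eventually (\<lambda>m. m = n) F"
  shows "F = principal {n}"
proof (rule filter_eqI)
  fix P
  have "P n" if "eventually P F"
    using eventually_conj[OF that assms(2)] assms(1)
    by (auto simp: ultrafilter_def dest: eventually_happens')
  moreover have "eventually P F" if "P n"
    using assms(2) by (rule eventually_mono) (use that in simp)
  ultimately show "eventually P F \<longleftrightarrow> eventually P (principal {n})"
    by (auto simp: eventually_principal)
qed

lemma ultrafilter_principal: "ultrafilter (principal {n})"
  by (auto simp: ultrafilter_def eventually_principal principal_eq_bot_iff)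

lemma topspace_beta_nat: "topspace beta_nat = Collect ultrafilter"
  by (auto simp: beta_nat_def intro!: exI[of _ UNIV])

lemma openin_beta_nat_base: "openin beta_nat {F. ultrafilter F \<and> eventually (\<lambda>n. n \<in> A) F}"
  unfolding beta_nat_def by (rule topology_generated_by_Basis) auto

lemma openin_beta_nat_eventually:
  assumes "openin beta_nat W" "F \<in> W"
  shows "eventually (\<lambda>n. principal {n} \<in> W) F"
proof -
  have "generate_topology_on (range (\<lambda>A. {F. ultrafilter F \<and> eventually (\<lambda>n. n \<in> A) F})) W"
    using assms(1) unfolding beta_nat_def by (rule openin_topology_generated_by)
  then have "\<forall>F \<in> W. eventually (\<lambda>n. principal {n} \<in> W) F"
  proof induction
    case (UN K)
    show ?case
    proof
      fix F assume "F \<in> \<Union>K"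
      then obtain k where k: "k \<in> K" "F \<in> k" by blast
      then have "eventually (\<lambda>n. principal {n} \<in> k) F" using UN.IH by blast
      then show "eventually (\<lambda>n. principal {n} \<in> \<Union>K) F"
        by (rule eventually_mono) (use k in blast)
    qed
  qed (auto simp: ultrafilter_principal eventually_principal intro: eventually_conj)
  then show ?thesis using assms(2) by blast
qed

lemma openin_beta_nat_subtopology:
  assumes p: "p \<in> topspace beta_nat - nat_points"
  shows "openin (subtopology beta_nat (nat_points \<union> {p})) U \<longleftrightarrow>
    U \<subseteq> nat_points \<union> {p} \<and> (p \<in> U \<longrightarrow> eventually (\<lambda>n. principal {n} \<in> U) p)"
proof (intro iffI conjI impI)
  assume U: "openin (subtopology beta_nat (nat_points \<union> {p})) U"
  then show "U \<subseteq> nat_points \<union> {p}" by (metis inf.boundedE openin_subset topspace_subtopology)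
  obtain W where W: "openin beta_nat W" "U = W \<inter> (nat_points \<union> {p})"
    using U by (auto simp: openin_subtopology)
  assume "p \<in> U"
  then show "eventually (\<lambda>n. principal {n} \<in> U) p"
    using openin_beta_nat_eventually[OF W(1), of p] W(2)
    by (auto simp: nat_points_def elim!: eventually_mono)
next
  let ?B = "\<lambda>A. {F. ultrafilter F \<and> eventually (\<lambda>n. n \<in> A) F}"
  define A where "A = {n. principal {n} \<in> U}"
  assume R: "U \<subseteq> nat_points \<union> {p} \<and> (p \<in> U \<longrightarrow> eventually (\<lambda>n. principal {n} \<in> U) p)"
  have pu: "ultrafilter p" "p \<notin> nat_points" using p by (auto simp: topspace_beta_nat)
  define W where "W = (if p \<in> U then ?B A else (\<Union>n\<in>A. ?B {n}))"
  have "openin beta_nat W"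
    unfolding W_def using openin_beta_nat_base by (simp only: if_split) (blast intro: openin_Union)
  moreover have "F \<in> U \<longleftrightarrow> F \<in> W" if "F \<in> nat_points \<union> {p}" for F
  proof (cases "F = p")
    case True
    have "\<not> eventually (\<lambda>m. m \<in> {n}) p" for n
      using pu ultrafilter_eq_principal[of p n] by (auto simp: nat_points_def)
    then show ?thesis using True R pu by (auto simp: W_def A_def)
  next
    case False
    then obtain n where "F = principal {n}" using \<open>F \<in> nat_points \<union> {p}\<close> by (auto simp: nat_points_def)
    then show ?thesis
      by (auto simp: W_def A_def ultrafilter_principal eventually_principal)
  qed
  then have "U = W \<inter> (nat_points \<union> {p})" using R by blast
  ultimately show "openin (subtopology beta_nat (nat_points \<union> {p})) U"
    by (auto simp: openin_subtopology)
qed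

text \<open>The intrinsic description. Without the Hausdorff property the trace of the neighbourhood
  filter could be a principal ultrafilter.\<close>

lemma elementary_space_iff:
  "elementary_space X \<longleftrightarrow>
     Hausdorff_space X \<and> countable (topspace X) \<and> infinite (topspace X) \<and>
     (\<exists>x \<in> topspace X. \<not> openin X {x} \<and> (\<forall>y \<in> topspace X - {x}. openin X {y}) \<and>
        ultrafilter (atin X x))" (is "_ \<longleftrightarrow> ?R")
proof
  assume "elementary_space X"
  then obtain p where p: "p \<in> topspace beta_nat - nat_points"
    and "X homeomorphic_space subtopology beta_nat (nat_points \<union> {p})"
    by (auto simp: elementary_space_def)
  define L where "L = subtopology beta_nat (nat_points \<union> {p})"
  have "L homeomorphic_space X"
    unfolding L_def using \<open>X homeomorphic_space _\<close> by (rule homeomorphic_space_sym[THEN iffD1])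
  then obtain f where f: "homeomorphic_map L X f" using homeomorphic_space by blast
  have pu: "ultrafilter p" "p \<notin> nat_points" using p by (auto simp: topspace_beta_nat)
  have np: "eventually (\<lambda>m. m \<noteq> n) p" for n
    using pu ultrafilter_eq_principal[of p n] by (auto simp: nat_points_def ultrafilter_def)
  have tL: "topspace L = nat_points \<union> {p}"
    using p by (auto simp: L_def topspace_beta_nat nat_points_def ultrafilter_principal)
  have oL: "openin L U \<longleftrightarrow> U \<subseteq> nat_points \<union> {p} \<and>
      (p \<in> U \<longrightarrow> eventually (\<lambda>n. principal {n} \<in> U) p)" for U
    unfolding L_def by (rule openin_beta_nat_subtopology[OF p])
  have oX: "openin X (f ` U) \<longleftrightarrow> openin L U" if "U \<subseteq> nat_points \<union> {p}" for U
    using homeomorphic_map_openness[OF f, of U] that tL by simp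
  have tX: "topspace X = f ` (nat_points \<union> {p})" using homeomorphic_imp_surjective_map[OF f] tL by simp
  have inj: "inj_on f (nat_points \<union> {p})" using homeomorphic_imp_injective_map[OF f] tL by simp
  have injp: "inj (\<lambda>n::nat. principal {n})" by (auto simp: inj_on_def)
  have pn: "p \<noteq> principal {n}" for n using pu by (auto simp: nat_points_def)
  have haus: "Hausdorff_space L"
    unfolding Hausdorff_space_def
  proof (intro allI impI, elim conjE)
    fix F F' assume F: "F \<in> topspace L" "F' \<in> topspace L" "F \<noteq> F'"
    have sep: "\<exists>U V. openin L U \<and> openin L V \<and> F \<in> U \<and> F' \<in> V \<and> disjnt U V"
      if "F \<in> nat_points" "F' \<in> topspace L" "F \<noteq> F'" for F F'
      using that np pn
      by (intro exI[of _ "{F}"] exI[of _ "nat_points \<union> {p} - {F}"])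
        (auto simp: oL tL disjnt_def nat_points_def)
    show "\<exists>U V. openin L U \<and> openin L V \<and> F \<in> U \<and> F' \<in> V \<and> disjnt U V"
      using sep[of F F'] sep[of F' F] F tL by (metis Un_iff disjnt_sym singletonD)
  qed
  have "Hausdorff_space X"
    using haus \<open>L homeomorphic_space X\<close> homeomorphic_Hausdorff_space by blast
  moreover have "countable (topspace X)" by (simp add: tX nat_points_def)
  moreover have "infinite (topspace X)"
    using inj injp finite_imageD[of f "nat_points \<union> {p}"] range_inj_infinite[OF injp]
    by (auto simp: tX nat_points_def)
  moreover have "f p \<in> topspace X" by (simp add: tX)
  moreover have nop: "\<not> openin X {f p}"
    using oX[of "{p}"] pn[symmetric] pu by (auto simp: oL ultrafilter_def trivial_limit_def)
  moreover have "openin X {y}" if "y \<in> topspace X - {f p}" for y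
  proof -
    obtain F where "F \<in> nat_points" "y = f F" using \<open>y \<in> _\<close> tX by auto
    then show ?thesis using oX[of "{F}"] pu by (auto simp: oL)
  qed
  moreover have "ultrafilter (atin X (f p))"
    unfolding ultrafilter_def
  proof (intro conjI allI)
    show "atin X (f p) \<noteq> bot"
    proof
      assume "atin X (f p) = bot"
      then have "eventually (\<lambda>_. False) (atin X (f p))" by simp
      then obtain U where "openin X U" "f p \<in> U" "U - {f p} = {}"
        using \<open>f p \<in> topspace X\<close> by (auto simp: eventually_atin)
      then have "U = {f p}" by auto
      with nop \<open>openin X U\<close> show False by simp
    qed
    fix P
    have *: "eventually Q (atin X (f p))" if "eventually (\<lambda>n. Q (f (principal {n}))) p" for Q
    proof -
      define U where "U = insert p {F \<in> nat_points. Q (f F)}"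
      have "openin L U" using that by (auto simp: oL U_def nat_points_def elim: eventually_mono)
      then have "openin X (f ` U)" using oX[of U] oL by blast
      moreover have "\<forall>y \<in> f ` U - {f p}. Q y" by (auto simp: U_def)
      ultimately show ?thesis
        unfolding eventually_atin by (metis U_def image_eqI insertI1)
    qed
    show "eventually P (atin X (f p)) \<or> eventually (\<lambda>x. \<not> P x) (atin X (f p))"
      using *[of P] *[of "\<lambda>x. \<not> P x"] pu by (auto simp: ultrafilter_def)
  qed
  ultimately show ?R by blast
next
  assume ?R
  then obtain x where haus: "Hausdorff_space X" and "countable (topspace X)" "infinite (topspace X)"
    and x: "x \<in> topspace X" "\<And>y. y \<in> topspace X - {x} \<Longrightarrow> openin X {y}"
    and uf: "ultrafilter (atin X x)" by blast
  then obtain b :: "nat \<Rightarrow> 'a" where b: "bij_betw b UNIV (topspace X - {x})"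
    using countableE_infinite[of "topspace X - {x}"] bij_betw_inv_into
    by (metis countable_Diff infinite_remove)
  define c where "c = inv_into UNIV b"
  have bc: "b (c y) = y" if "y \<in> topspace X - {x}" for y
    using b that by (auto simp: c_def bij_betw_def f_inv_into_f)
  have cb: "c (b n) = n" for n using b by (auto simp: c_def bij_betw_def)
  have bX: "b n \<in> topspace X" "b n \<noteq> x" for n using b by (auto simp: bij_betw_def)
  define p where "p = filtermap c (atin X x)"
  have evX: "eventually (\<lambda>y. y \<in> topspace X - {x}) (atin X x)"
    using x(1) by (auto simp: eventually_atin intro: exI[of _ "topspace X"])
  have pu: "ultrafilter p"
    using uf by (auto simp: ultrafilter_def p_def eventually_filtermap filtermap_bot_iff)
  have "p \<noteq> principal {n}" for n
  proof
    assume "p = principal {n}"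
    then have "eventually (\<lambda>m. m = n) p" by (simp add: eventually_principal)
    then have "eventually (\<lambda>y. c y = n) (atin X x)" by (simp add: p_def eventually_filtermap)
    with evX have "eventually (\<lambda>y. y = b n) (atin X x)"
      by eventually_elim (use bc in auto)
    moreover obtain U V where "openin X U" "openin X V" "x \<in> U" "b n \<in> V" "disjnt U V"
      using haus x(1) bX[of n] unfolding Hausdorff_space_def by metis
    then have "eventually (\<lambda>y. y \<noteq> b n) (atin X x)"
      by (auto simp: eventually_atin disjnt_def)
    ultimately have "eventually (\<lambda>_. False) (atin X x)" by eventually_elim simp
    then show False using uf by (simp add: ultrafilter_def trivial_limit_def)
  qed
  then have p: "p \<in> topspace beta_nat - nat_points"
    using pu by (auto simp: topspace_beta_nat nat_points_def)
  have pn: "p \<noteq> principal {n}" for n by fact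
  define L where "L = subtopology beta_nat (nat_points \<union> {p})"
  have tL: "topspace L = nat_points \<union> {p}"
    using p by (auto simp: L_def topspace_beta_nat nat_points_def ultrafilter_principal)
  have oL: "openin L U \<longleftrightarrow> U \<subseteq> nat_points \<union> {p} \<and>
      (p \<in> U \<longrightarrow> eventually (\<lambda>n. principal {n} \<in> U) p)" for U
    unfolding L_def by (rule openin_beta_nat_subtopology[OF p])
  have oX: "openin X U \<longleftrightarrow> U \<subseteq> topspace X \<and> (x \<in> U \<longrightarrow> eventually (\<lambda>y. y \<in> U) (atin X x))" for U
  proof (intro iffI conjI impI; (elim conjE)?)
    assume "openin X U"
    then show "U \<subseteq> topspace X" by (rule openin_subset)
    assume "x \<in> U"
    then show "eventually (\<lambda>y. y \<in> U) (atin X x)"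
      using \<open>openin X U\<close> by (auto simp: eventually_atin)
  next
    assume U: "U \<subseteq> topspace X" "x \<in> U \<longrightarrow> eventually (\<lambda>y. y \<in> U) (atin X x)"
    show "openin X U"
    proof (subst openin_subopen, intro ballI)
      fix y assume "y \<in> U"
      show "\<exists>V. openin X V \<and> y \<in> V \<and> V \<subseteq> U"
      proof (cases "y = x")
        case True
        then obtain V where "openin X V" "x \<in> V" "\<forall>y \<in> V - {x}. y \<in> U"
          using U \<open>y \<in> U\<close> x(1) by (auto simp: eventually_atin)
        then show ?thesis using True \<open>y \<in> U\<close> by blast
      next
        case False
        then show ?thesis using x(2)[of y] U \<open>y \<in> U\<close> by blast
      qed
    qed
  qed
  define h where "h y = (if y = x then p else principal {c y})" for y
  have hb: "h (b n) = principal {n}" for n using bX by (simp add: h_def cb)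
  have hx: "h x = p" by (simp add: h_def)
  have himg: "h ` topspace X = nat_points \<union> {p}"
  proof
    show "h ` topspace X \<subseteq> nat_points \<union> {p}" by (auto simp: h_def nat_points_def)
    show "nat_points \<union> {p} \<subseteq> h ` topspace X"
      using bX hb hx x(1) by (auto simp: nat_points_def) (metis image_eqI)+
  qed
  have hinj: "inj_on h (topspace X)"
  proof (rule inj_onI)
    fix y z assume "y \<in> topspace X" "z \<in> topspace X" "h y = h z"
    then show "y = z" using pn bc by (auto simp: h_def split: if_splits) (metis DiffI singletonD)+
  qed
  have key: "openin L (h ` V) \<longleftrightarrow> openin X V" if V: "V \<subseteq> topspace X" for V
  proof -
    have mem: "h y \<in> h ` V \<longleftrightarrow> y \<in> V" if "y \<in> topspace X" for y
      using inj_on_image_mem_iff[OF hinj that V] .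
    have "eventually (\<lambda>n. principal {n} \<in> h ` V) p \<longleftrightarrow>
        eventually (\<lambda>y. principal {c y} \<in> h ` V) (atin X x)"
      by (simp add: p_def eventually_filtermap)
    also have "\<dots> \<longleftrightarrow> eventually (\<lambda>y. y \<in> V) (atin X x)"
    proof (rule eventually_cong[OF evX])
      fix y assume y: "y \<in> topspace X - {x}"
      then have "h y = principal {c y}" by (simp add: h_def)
      then show "principal {c y} \<in> h ` V \<longleftrightarrow> y \<in> V" using mem[of y] y by simp
    qed
    finally show ?thesis
      using V himg mem[OF x(1)] unfolding hx oL oX by blast
  qed
  have "continuous_map X L h"
    unfolding continuous_map
  proof (intro conjI allI impI)
    show "h ` topspace X \<subseteq> topspace L" by (simp add: himg tL)
    fix U assume U: "openin L U"
    then have "U \<subseteq> h ` topspace X" using himg tL openin_subset by metis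
    then have "h ` {y \<in> topspace X. h y \<in> U} = U" by blast
    then show "openin X {y \<in> topspace X. h y \<in> U}"
      using U key[of "{y \<in> topspace X. h y \<in> U}"] by simp
  qed
  moreover have "open_map X L h"
    unfolding open_map_def using key openin_subset by blast
  ultimately have "homeomorphic_map X L h"
    using himg hinj tL by (intro bijective_open_imp_homeomorphic_map) auto
  then show "elementary_space X"
    unfolding elementary_space_def using p homeomorphic_map_imp_homeomorphic_space L_def by blast
qed


section \<open>Precompact Boolean groups\<close>

locale topological_group = group G for G :: "'a monoid" (structure) +
  fixes T :: "'a topology"
  assumes topspace_eq: "topspace T = carrier G"
    and continuous_mult: "continuous_map (prod_topology T T) T (\<lambda>(x, y). x \<otimes> y)"
    and continuous_inv: "continuous_map T T (\<lambda>x. inv x)"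

text \<open>The compact group is sought on the type \<open>'a set set\<close>. This is no restriction: see
  \<open>precompact_groupI\<close> below, where the compact group may live on any type.\<close>

definition precompact_group :: "'a monoid \<Rightarrow> 'a topology \<Rightarrow> bool" where
  "precompact_group G T \<longleftrightarrow> topological_group G T \<and>
     (\<exists>(K :: 'a set set monoid) S h. topological_group K S \<and> compact_space S \<and> Hausdorff_space S \<and>
        h \<in> hom G K \<and> embedding_map T S h)"

definition precompact_Boolean_group :: "'a monoid \<Rightarrow> 'a topology \<Rightarrow> bool" where
  "precompact_Boolean_group G T \<longleftrightarrow>
     precompact_group G T \<and> (\<forall>g \<in> carrier G. g \<otimes>\<^bsub>G\<^esub> g = \<one>\<^bsub>G\<^esub>)"

text \<open>The free object is given by its universal property, hence up to isomorphism.
  A definition cannot quantify over types, so the test groups \<open>H\<close> are taken on the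
  type \<open>'x set + 'g\<close>. It is large enough to imply the universal property for test groups on
  an arbitrary type: see \<open>free_precompact_Boolean_group_universal\<close> below. Homomorphisms are
  made \<open>undefined\<close> outside the carrier to let \<open>\<exists>!\<close> express uniqueness on the carrier.\<close>

definition free_precompact_Boolean_group ::
    "'x topology \<Rightarrow> 'g monoid \<Rightarrow> 'g topology \<Rightarrow> ('x \<Rightarrow> 'g) \<Rightarrow> bool" where
  "free_precompact_Boolean_group X G T \<eta> \<longleftrightarrow>
     precompact_Boolean_group G T \<and> continuous_map X T \<eta> \<and>
     (\<forall>(H :: ('x set + 'g) monoid) S \<phi>.
        precompact_Boolean_group H S \<and> continuous_map X S \<phi> \<longrightarrow>
        (\<exists>!\<Phi>. \<Phi> \<in> hom G H \<inter> extensional (carrier G) \<and> continuous_map T S \<Phi> \<and>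
              (\<forall>x \<in> topspace X. \<Phi> (\<eta> x) = \<phi> x)))"


section \<open>The choice of types is immaterial\<close>

lemma (in topological_group) topological_group_subgroup:
  assumes "subgroup D G"
  shows "topological_group (G\<lparr>carrier := D\<rparr>) (subtopology T D)"
proof -
  interpret D: subgroup D G by fact
  have grp: "group (G\<lparr>carrier := D\<rparr>)"
    using assms by (rule subgroup.subgroup_is_group) (rule is_group)
  interpret GD: group "G\<lparr>carrier := D\<rparr>" by fact
  have ts: "topspace (subtopology T D) = D"
    using D.subset topspace_eq by auto
  have "continuous_map (prod_topology (subtopology T D) (subtopology T D)) T (\<lambda>(x, y). x \<otimes> y)"
    using continuous_map_from_subtopology[OF continuous_mult, of "D \<times> D"]
    by (simp add: subtopology_Times)
  then have m: "continuous_map (prod_topology (subtopology T D) (subtopology T D)) (subtopology T D)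
      (\<lambda>(x, y). x \<otimes> y)"
    by (rule continuous_map_into_subtopology) (auto simp: ts)
  have "continuous_map (subtopology T D) (subtopology T D) (\<lambda>x. inv x)"
    by (rule continuous_map_into_subtopology)
      (use continuous_map_from_subtopology[OF continuous_inv] in \<open>auto simp: ts\<close>)
  then have i: "continuous_map (subtopology T D) (subtopology T D) (\<lambda>x. inv\<^bsub>G\<lparr>carrier := D\<rparr>\<^esub> x)"
    by (rule continuous_map_eq) (use assms ts in \<open>auto simp: m_inv_consistent\<close>)
  show ?thesis
    by unfold_locales (use ts m i in auto)
qed

lemma (in topological_group) subgroup_closure_of:
  assumes "subgroup D G"
  shows "subgroup (T closure_of D) G"
proof -
  interpret D: subgroup D G by fact
  have sub: "D \<subseteq> T closure_of D"
    by (simp add: closure_of_subset D.subset topspace_eq)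
  have m: "(\<lambda>(x, y). x \<otimes> y) ` (prod_topology T T closure_of (D \<times> D)) \<subseteq> T closure_of D"
    using continuous_map_image_closure_subset[OF continuous_mult, of "D \<times> D"]
      closure_of_mono[of "(\<lambda>(x, y). x \<otimes> y) ` (D \<times> D)" D T] by fastforce
  have i: "(\<lambda>x. inv x) ` (T closure_of D) \<subseteq> T closure_of D"
    using continuous_map_image_closure_subset[OF continuous_inv, of D]
      closure_of_mono[of "(\<lambda>x. inv x) ` D" D T] by fastforce
  show ?thesis
  proof (rule subgroup.intro)
    show "T closure_of D \<subseteq> carrier G"
      using closure_of_subset_topspace topspace_eq by fastforce
    show "\<one> \<in> T closure_of D" using sub by auto
    show "x \<otimes> y \<in> T closure_of D" if "x \<in> T closure_of D" "y \<in> T closure_of D" for x y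
      using m that by (fastforce simp: closure_of_Times)
    show "inv x \<in> T closure_of D" if "x \<in> T closure_of D" for x
      using i that by auto
  qed
qed

lemma (in topological_group) transport:
  fixes e :: "'a \<Rightarrow> 'b"
  assumes inj: "inj_on e (carrier G)"
  obtains H S f where "topological_group H S" "carrier H = e ` carrier G"
    "homeomorphic_maps T S e f" "e \<in> hom G H" "f \<in> hom H G"
proof -
  define f where "f = inv_into (carrier G) e"
  define H where "H = \<lparr>carrier = e ` carrier G, mult = (\<lambda>a b. e (f a \<otimes> f b)), one = e \<one>\<rparr>"
  define S where "S = pullback_topology (e ` carrier G) f T"
  have fe: "f (e x) = x" if "x \<in> carrier G" for x
    using inj that by (simp add: f_def)
  have carH: "carrier H = e ` carrier G" by (simp add: H_def)
  have multH: "a \<otimes>\<^bsub>H\<^esub> b = e (f a \<otimes> f b)" for a b by (simp add: H_def)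
  have oneH: "\<one>\<^bsub>H\<^esub> = e \<one>" by (simp add: H_def)
  have grp: "group H"
  proof (rule groupI)
    show "\<exists>y\<in>carrier H. y \<otimes>\<^bsub>H\<^esub> x = \<one>\<^bsub>H\<^esub>" if "x \<in> carrier H" for x
      using that by (intro bexI[of _ "e (inv (f x))"]) (auto simp: carH multH oneH fe)
  qed (auto simp: carH multH oneH fe m_assoc)
  interpret H: group H by fact
  have e: "e \<in> hom G H" by (auto simp: hom_def carH multH fe)
  have f: "f \<in> hom H G" by (auto simp: hom_def carH multH fe)
  have tsS: "topspace S = carrier H"
    by (auto simp: S_def topspace_pullback_topology carH topspace_eq fe)
  have cf: "continuous_map S T f"
    using continuous_map_pullback[of T T id "e ` carrier G" f] by (simp add: S_def)
  have ce: "continuous_map T S e"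
    unfolding S_def
  proof (rule continuous_map_pullback')
    show "continuous_map T T (f \<circ> e)"
      by (rule continuous_map_eq[OF continuous_map_id]) (auto simp: fe topspace_eq)
  qed (auto simp: topspace_eq)
  have hm: "homeomorphic_maps T S e f"
    using ce cf by (auto simp: homeomorphic_maps_def topspace_eq tsS carH fe)
  have invH: "inv\<^bsub>H\<^esub> x = e (inv (f x))" if "x \<in> carrier H" for x
    using that by (intro H.inv_equality) (auto simp: carH multH oneH fe)
  have cff: "continuous_map (prod_topology S S) (prod_topology T T) (\<lambda>(x, y). (f x, f y))"
    using cf by (simp add: continuous_map_prod_top)
  have "continuous_map (prod_topology S S) S (e \<circ> (\<lambda>(x, y). x \<otimes> y) \<circ> (\<lambda>(x, y). (f x, f y)))"
    using cff continuous_mult ce by (blast intro: continuous_map_compose)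
  then have m: "continuous_map (prod_topology S S) S (\<lambda>(x, y). x \<otimes>\<^bsub>H\<^esub> y)"
    by (rule continuous_map_eq) (auto simp: multH)
  have "continuous_map S S (e \<circ> (\<lambda>x. inv x) \<circ> f)"
    using cf continuous_inv ce by (blast intro: continuous_map_compose)
  then have i: "continuous_map S S (\<lambda>x. inv\<^bsub>H\<^esub> x)"
    by (rule continuous_map_eq) (auto simp: invH tsS)
  have "topological_group H S"
    by unfold_locales (use tsS m i in auto)
  then show thesis using that hm e f carH by blast
qed

lemma homeomorphic_map_imp_embedding_map: "homeomorphic_map X Y f \<Longrightarrow> embedding_map X Y f"
  by (simp add: embedding_map_def homeomorphic_imp_surjective_map)

lemma precompact_groupI:
  fixes G :: "'a monoid" and K :: "'k monoid"
  assumes G: "topological_group G T" and K: "topological_group K S"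
    and cpt: "compact_space S" and haus: "Hausdorff_space S"
    and h: "h \<in> hom G K" and emb: "embedding_map T S h"
  shows "precompact_group G T"
proof -
  interpret G: topological_group G T by fact
  interpret K: topological_group K S by fact
  define D where "D = h ` carrier G"
  have "subgroup D K"
    unfolding D_def using h
    by (intro group_hom.img_is_subgroup) (simp add: group_hom_def group_hom_axioms_def G.is_group K.is_group)
  then have sgC: "subgroup (S closure_of D) K" by (rule K.subgroup_closure_of)
  define C where "C = S closure_of D"
  have DC: "D \<subseteq> C" and CK: "C \<subseteq> carrier K"
    using \<open>subgroup D K\<close> sgC by (auto simp: C_def closure_of_subset subgroup.subset K.topspace_eq)
  define K' where "K' = K\<lparr>carrier := C\<rparr>"
  define S' where "S' = subtopology S C"
  interpret K': topological_group K' S'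
    unfolding K'_def S'_def using sgC C_def by (intro K.topological_group_subgroup) simp
  define e where "e k = {h -` U \<inter> carrier G | U. openin S U \<and> k \<in> U}" for k
  have "inj_on e (carrier K')"
  proof (rule inj_onI, rule ccontr)
    fix k l assume kl: "k \<in> carrier K'" "l \<in> carrier K'" "e k = e l" "k \<noteq> l"
    have "k \<in> topspace S" "l \<in> topspace S" using kl CK by (auto simp: K'_def K.topspace_eq)
    then obtain U V where UV: "openin S U" "openin S V" "k \<in> U" "l \<in> V" "disjnt U V"
      using haus kl(4) unfolding Hausdorff_space_def by metis
    have "h -` U \<inter> carrier G \<in> e k" using UV by (auto simp: e_def)
    then have "h -` U \<inter> carrier G \<in> e l" using kl(3) by simp
    then obtain W where W: "openin S W" "l \<in> W" "h -` U \<inter> carrier G = h -` W \<inter> carrier G"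
      unfolding e_def by blast
    have "l \<in> V \<inter> W" "openin S (V \<inter> W)" using UV W by auto
    moreover have "l \<in> S closure_of D" using kl(2) by (simp add: K'_def C_def)
    ultimately obtain d where "d \<in> D" "d \<in> V \<inter> W"
      by (meson in_closure_of)
    then show False using W(3) UV(5) by (auto simp: D_def disjnt_def)
  qed
  then obtain L :: "'a set set monoid" and R f where L: "topological_group L R"
    and "homeomorphic_maps S' R e f" and e: "e \<in> hom K' L"
    by (rule K'.transport)
  then have hmap: "homeomorphic_map S' R e" using homeomorphic_maps_imp_map by blast
  then have hs: "S' homeomorphic_space R" by (rule homeomorphic_map_imp_homeomorphic_space)
  have "compact_space S'"
    unfolding S'_def by (intro compact_space_subtopology closedin_compact_space cpt)
      (simp add: C_def)
  then have "compact_space R" using hs homeomorphic_compact_space by blast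
  moreover have "Hausdorff_space R"
    using haus hs Hausdorff_space_subtopology homeomorphic_Hausdorff_space unfolding S'_def by blast
  moreover have "h \<in> hom G K'"
    using h DC by (auto simp: hom_def K'_def D_def)
  then have "e \<circ> h \<in> hom G L" using e by (rule Group.hom_compose)
  moreover have "h ` topspace T \<subseteq> C" using DC by (auto simp: D_def G.topspace_eq)
  then have "embedding_map T S' h"
    using emb by (auto simp: S'_def embedding_map_in_subtopology)
  then have "embedding_map T R (e \<circ> h)"
    using hmap by (blast intro: embedding_map_compose homeomorphic_map_imp_embedding_map)
  ultimately show ?thesis
    unfolding precompact_group_def using L G by blast
qed

lemma precompact_group_topological_group: "precompact_group G T \<Longrightarrow> topological_group G T"
  by (simp add: precompact_group_def)

lemma precompact_Boolean_groupD:
  assumes "precompact_Boolean_group H S"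
  shows "topological_group H S" "comm_group H" "g \<in> carrier H \<Longrightarrow> g \<otimes>\<^bsub>H\<^esub> g = \<one>\<^bsub>H\<^esub>"
    "g \<in> carrier H \<Longrightarrow> inv\<^bsub>H\<^esub> g = g" "topspace S = carrier H"
proof -
  show H: "topological_group H S"
    using assms by (simp add: precompact_Boolean_group_def precompact_group_topological_group)
  then interpret topological_group H S .
  show sq: "g \<otimes>\<^bsub>H\<^esub> g = \<one>\<^bsub>H\<^esub>" if "g \<in> carrier H" for g
    using assms that by (simp add: precompact_Boolean_group_def)
  show iv: "inv\<^bsub>H\<^esub> g = g" if "g \<in> carrier H" for g
    using sq that by (simp add: inv_equality)
  show "comm_group H"
    by (rule group_comm_groupI) (metis iv inv_mult_group m_closed)
  show "topspace S = carrier H" by (rule topspace_eq)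
qed

lemma precompact_Boolean_group_subgroup:
  assumes H: "precompact_Boolean_group H S" and D: "subgroup D H"
  shows "precompact_Boolean_group (H\<lparr>carrier := D\<rparr>) (subtopology S D)"
proof -
  interpret topological_group H S using H by (rule precompact_Boolean_groupD)
  interpret D: subgroup D H by fact
  obtain K :: "'a set set monoid" and R h where K: "topological_group K R" "compact_space R"
    "Hausdorff_space R" "h \<in> hom H K" "embedding_map S R h"
    using H unfolding precompact_Boolean_group_def precompact_group_def by blast
  have "embedding_map (subtopology S D) R h"
  proof -
    have "D \<subseteq> topspace S" using D.subset topspace_eq by simp
    have hm: "homeomorphic_map S (subtopology R (h ` topspace S)) h"
      using K(5) by (simp add: embedding_map_def)
    then have "topspace (subtopology R (h ` topspace S)) = h ` topspace S"
      by (metis homeomorphic_imp_surjective_map)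
    then have "h ` (topspace S \<inter> D) = topspace (subtopology R (h ` topspace S)) \<inter> h ` D"
      using \<open>D \<subseteq> topspace S\<close> by (simp only:) blast
    with hm have "homeomorphic_map (subtopology S D) (subtopology (subtopology R (h ` topspace S)) (h ` D)) h"
      by (rule homeomorphic_map_subtopologies)
    moreover have "h ` topspace S \<inter> h ` D = h ` topspace (subtopology S D)"
      using \<open>D \<subseteq> topspace S\<close> by auto
    ultimately show ?thesis
      by (simp add: embedding_map_def subtopology_subtopology)
  qed
  moreover have "h \<in> hom (H\<lparr>carrier := D\<rparr>) K"
    using K(4) D.subset by (auto simp: hom_def)
  ultimately have "precompact_group (H\<lparr>carrier := D\<rparr>) (subtopology S D)"
    using topological_group_subgroup[OF D] K by (intro precompact_groupI)
  then show ?thesis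
    using precompact_Boolean_groupD(3)[OF H] by (simp add: precompact_Boolean_group_def)
qed

lemma precompact_Boolean_group_transport:
  fixes H :: "'h monoid" and e :: "'h \<Rightarrow> 'b"
  assumes H: "precompact_Boolean_group H S" and inj: "inj_on e (carrier H)"
  obtains H' S' f where "precompact_Boolean_group H' S'" "homeomorphic_maps S S' e f"
    "e \<in> hom H H'" "f \<in> hom H' H"
proof -
  interpret topological_group H S using H by (rule precompact_Boolean_groupD)
  obtain H' S' f where H': "topological_group H' S'" "carrier H' = e ` carrier H"
    "homeomorphic_maps S S' e f" "e \<in> hom H H'" "f \<in> hom H' H"
    using transport[OF inj] by metis
  interpret H': topological_group H' S' by fact
  obtain K :: "'h set set monoid" and R h where K: "topological_group K R" "compact_space R"
    "Hausdorff_space R" "h \<in> hom H K" "embedding_map S R h"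
    using H unfolding precompact_Boolean_group_def precompact_group_def by blast
  have "h \<circ> f \<in> hom H' K" using H'(5) K(4) by (rule Group.hom_compose)
  moreover have "embedding_map S' R (h \<circ> f)"
    using H'(3) K(5) by (metis embedding_map_compose homeomorphic_map_imp_embedding_map
        homeomorphic_maps_map)
  ultimately have "precompact_group H' S'"
    using H' K by (intro precompact_groupI)
  moreover have "g \<otimes>\<^bsub>H'\<^esub> g = \<one>\<^bsub>H'\<^esub>" if "g \<in> carrier H'" for g
  proof -
    obtain x where x: "x \<in> carrier H" "g = e x" using \<open>g \<in> carrier H'\<close> H' by auto
    then have "g \<otimes>\<^bsub>H'\<^esub> g = e (x \<otimes>\<^bsub>H\<^esub> x)" using hom_mult[OF H'(4)] by simp
    then show ?thesis
      using precompact_Boolean_groupD(3)[OF H] x hom_one[OF H'(4)] H'.is_group by simp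
  qed
  ultimately have "precompact_Boolean_group H' S'"
    by (simp add: precompact_Boolean_group_def)
  then show thesis using that H' by blast
qed

lemma free_precompact_Boolean_group_ex_inj:
  fixes X :: "'x topology" and G :: "'g monoid" and H :: "'h monoid" and e :: "'h \<Rightarrow> 'x set + 'g"
  assumes free: "free_precompact_Boolean_group X G T \<eta>"
    and H: "precompact_Boolean_group H S" and e: "inj_on e (carrier H)"
    and \<phi>: "continuous_map X S \<phi>"
  shows "\<exists>\<Phi>. \<Phi> \<in> hom G H \<and> continuous_map T S \<Phi> \<and> (\<forall>x \<in> topspace X. \<Phi> (\<eta> x) = \<phi> x)"
proof -
  obtain H' :: "('x set + 'g) monoid" and S' f where H': "precompact_Boolean_group H' S'"
    and ef: "homeomorphic_maps S S' e f" "e \<in> hom H H'" "f \<in> hom H' H"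
    using precompact_Boolean_group_transport[OF H e] by metis
  have "continuous_map X S' (e \<circ> \<phi>)"
    using \<phi> ef by (auto simp: homeomorphic_maps_def intro: continuous_map_compose)
  then obtain \<Psi> where \<Psi>: "\<Psi> \<in> hom G H'" "continuous_map T S' \<Psi>"
    "\<forall>x \<in> topspace X. \<Psi> (\<eta> x) = (e \<circ> \<phi>) x"
    using free H' unfolding free_precompact_Boolean_group_def by blast
  have "f \<circ> \<Psi> \<in> hom G H" using \<Psi> ef by (blast intro: Group.hom_compose)
  moreover have "continuous_map T S (f \<circ> \<Psi>)"
    using \<Psi> ef by (auto simp: homeomorphic_maps_def intro: continuous_map_compose)
  moreover have "(f \<circ> \<Psi>) (\<eta> x) = \<phi> x" if "x \<in> topspace X" for x
    using \<Psi> ef that \<phi> by (auto simp: homeomorphic_maps_def continuous_map_def)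
  ultimately show ?thesis by blast
qed

lemma free_precompact_Boolean_group_unique_inj:
  fixes X :: "'x topology" and G :: "'g monoid" and H :: "'h monoid" and e :: "'h \<Rightarrow> 'x set + 'g"
  assumes free: "free_precompact_Boolean_group X G T \<eta>"
    and H: "precompact_Boolean_group H S" and e: "inj_on e (carrier H)"
    and \<Phi>: "\<Phi> \<in> hom G H" "continuous_map T S \<Phi>"
    and \<Psi>: "\<Psi> \<in> hom G H" "continuous_map T S \<Psi>"
    and agree: "\<And>x. x \<in> topspace X \<Longrightarrow> \<Phi> (\<eta> x) = \<Psi> (\<eta> x)"
    and g: "g \<in> carrier G"
  shows "\<Phi> g = \<Psi> g"
proof -
  have G: "precompact_Boolean_group G T" and \<eta>: "continuous_map X T \<eta>"
    using free by (auto simp: free_precompact_Boolean_group_def)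
  interpret G: topological_group G T using G by (rule precompact_Boolean_groupD)
  obtain H' :: "('x set + 'g) monoid" and S' f where H': "precompact_Boolean_group H' S'"
    and ef: "homeomorphic_maps S S' e f" "e \<in> hom H H'" "f \<in> hom H' H"
    using precompact_Boolean_group_transport[OF H e] by metis
  have ce: "continuous_map S S' e" using ef by (simp add: homeomorphic_maps_def)
  have \<eta>G: "\<eta> x \<in> carrier G" if "x \<in> topspace X" for x
    using \<eta> that G.topspace_eq by (auto simp: continuous_map_def)
  let ?P = "\<lambda>F. F \<in> hom G H' \<inter> extensional (carrier G) \<and> continuous_map T S' F \<and>
    (\<forall>x \<in> topspace X. F (\<eta> x) = (e \<circ> \<Phi> \<circ> \<eta>) x)"
  have c: "continuous_map X S' (e \<circ> \<Phi> \<circ> \<eta>)"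
    using \<eta> \<Phi> ce by (blast intro: continuous_map_compose)
  have un: "\<exists>!F. ?P F"
    using free H' c unfolding free_precompact_Boolean_group_def by blast
  have P: "?P (restrict (e \<circ> F) (carrier G))"
    if F: "F \<in> hom G H" "continuous_map T S F" "\<And>x. x \<in> topspace X \<Longrightarrow> F (\<eta> x) = \<Phi> (\<eta> x)" for F
  proof -
    have "e \<circ> F \<in> hom G H'" using F ef by (blast intro: Group.hom_compose)
    then have "restrict (e \<circ> F) (carrier G) \<in> hom G H'" by (auto simp: hom_def)
    moreover have "continuous_map T S' (e \<circ> F)" using F ce by (blast intro: continuous_map_compose)
    then have "continuous_map T S' (restrict (e \<circ> F) (carrier G))"
      by (rule continuous_map_eq) (simp add: G.topspace_eq)
    ultimately show ?thesis using F(3) \<eta>G by simp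
  qed
  have "restrict (e \<circ> \<Phi>) (carrier G) = restrict (e \<circ> \<Psi>) (carrier G)"
    using un P[OF \<Phi>] P[OF \<Psi>] agree by auto
  then have "e (\<Phi> g) = e (\<Psi> g)" using g by (metis comp_apply restrict_apply')
  then show ?thesis
    using e g \<Phi>(1) \<Psi>(1) by (auto simp: hom_def inj_on_def Pi_iff)
qed

lemma free_precompact_Boolean_group_universal:
  fixes X :: "'x topology" and G :: "'g monoid" and H :: "'h monoid"
  assumes free: "free_precompact_Boolean_group X G T \<eta>"
    and H: "precompact_Boolean_group H S" and \<phi>: "continuous_map X S \<phi>"
  shows "\<exists>!\<Phi>. \<Phi> \<in> hom G H \<inter> extensional (carrier G) \<and> continuous_map T S \<Phi> \<and>
            (\<forall>x \<in> topspace X. \<Phi> (\<eta> x) = \<phi> x)"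
proof (rule ex_ex1I)
  have G: "precompact_Boolean_group G T" and \<eta>: "continuous_map X T \<eta>"
    using free by (auto simp: free_precompact_Boolean_group_def)
  interpret G: topological_group G T using G by (rule precompact_Boolean_groupD)
  interpret G: comm_group G using G by (rule precompact_Boolean_groupD)
  interpret H: topological_group H S using H by (rule precompact_Boolean_groupD)
  interpret H: comm_group H using H by (rule precompact_Boolean_groupD)
  note sq = precompact_Boolean_groupD(3)[OF H] and iv = precompact_Boolean_groupD(4)[OF H]
  have \<phi>H: "\<phi> \<in> topspace X \<rightarrow> carrier H"
    using \<phi> H.topspace_eq by (auto simp: continuous_map_def)
  have \<eta>G: "\<eta> x \<in> carrier G" if "x \<in> topspace X" for x
    using \<eta> that G.topspace_eq by (auto simp: continuous_map_def)

  define Fin where "Fin = {F. finite F \<and> F \<subseteq> topspace X}"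
  define D where "D = finprod H \<phi> ` Fin"
  have clo: "finprod H \<phi> F \<in> carrier H" if "F \<in> Fin" for F
    using that \<phi>H by (intro H.finprod_closed) (auto simp: Fin_def)
  have mult: "finprod H \<phi> F \<otimes>\<^bsub>H\<^esub> finprod H \<phi> F' = finprod H \<phi> ((F - F') \<union> (F' - F))"
    if F: "F \<in> Fin" "F' \<in> Fin" for F F'
  proof -
    have split: "finprod H \<phi> A = finprod H \<phi> (A - B) \<otimes>\<^bsub>H\<^esub> finprod H \<phi> (A \<inter> B)" if "A \<in> Fin" for A B
      using \<phi>H that H.finprod_Un_disjoint[of "A - B" "A \<inter> B" \<phi>]
      by (auto simp: Fin_def Un_Diff_Int Pi_iff subset_iff)
    define a b c where "a = finprod H \<phi> (F - F')" and "b = finprod H \<phi> (F' - F)"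
      and "c = finprod H \<phi> (F \<inter> F')"
    have abc: "a \<in> carrier H" "b \<in> carrier H" "c \<in> carrier H"
      unfolding a_def b_def c_def using F by (auto intro!: clo simp: Fin_def)
    have "finprod H \<phi> F \<otimes>\<^bsub>H\<^esub> finprod H \<phi> F' = (a \<otimes>\<^bsub>H\<^esub> c) \<otimes>\<^bsub>H\<^esub> (b \<otimes>\<^bsub>H\<^esub> c)"
      using split[OF F(1), of F'] split[OF F(2), of F] by (simp add: a_def b_def c_def Int_commute)
    also have "\<dots> = (a \<otimes>\<^bsub>H\<^esub> b) \<otimes>\<^bsub>H\<^esub> (c \<otimes>\<^bsub>H\<^esub> c)" using abc by (simp add: H.m_ac)
    also have "\<dots> = a \<otimes>\<^bsub>H\<^esub> b" using abc sq by simp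
    also have "\<dots> = finprod H \<phi> ((F - F') \<union> (F' - F))"
      unfolding a_def b_def using F \<phi>H
      by (intro H.finprod_Un_disjoint[symmetric]) (auto simp: Fin_def Pi_iff subset_iff)
    finally show ?thesis .
  qed
  have D: "subgroup D H"
  proof (rule H.subgroupI)
    show "D \<subseteq> carrier H" using clo by (auto simp: D_def)
    show "D \<noteq> {}" by (auto simp: D_def Fin_def)
    show "inv\<^bsub>H\<^esub> a \<in> D" if "a \<in> D" for a
      using that iv clo by (auto simp: D_def)
    show "a \<otimes>\<^bsub>H\<^esub> b \<in> D" if ab: "a \<in> D" "b \<in> D" for a b
    proof -
      obtain F F' where "F \<in> Fin" "F' \<in> Fin" "a = finprod H \<phi> F" "b = finprod H \<phi> F'"
        using ab unfolding D_def by blast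
      moreover from this have "(F - F') \<union> (F' - F) \<in> Fin" by (auto simp: Fin_def)
      ultimately show ?thesis using mult by (simp add: D_def)
    qed
  qed
  have \<phi>D: "\<phi> x \<in> D" if "x \<in> topspace X" for x
  proof -
    have "\<phi> x \<in> carrier H" using that \<phi>H by auto
    then have "finprod H \<phi> {x} = \<phi> x" by simp
    moreover have "{x} \<in> Fin" using that by (simp add: Fin_def)
    ultimately show ?thesis unfolding D_def by (metis imageI)
  qed
  have "continuous_map X (subtopology S D) \<phi>"
    using \<phi> \<phi>D by (auto intro: continuous_map_into_subtopology)
  moreover have "inj_on (\<lambda>d. Inl (inv_into Fin (finprod H \<phi>) d) :: 'x set + 'g) D"
    unfolding D_def by (intro inj_onI) (rule inv_into_injective, auto)
  ultimately obtain \<Phi> where \<Phi>: "\<Phi> \<in> hom G (H\<lparr>carrier := D\<rparr>)"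
    "continuous_map T (subtopology S D) \<Phi>" "\<forall>x \<in> topspace X. \<Phi> (\<eta> x) = \<phi> x"
    using free_precompact_Boolean_group_ex_inj[OF free precompact_Boolean_group_subgroup[OF H D],
        of "\<lambda>d. Inl (inv_into Fin (finprod H \<phi>) d)" \<phi>] by auto
  have "restrict \<Phi> (carrier G) \<in> hom G H"
    using \<Phi>(1) subgroup.subset[OF D] by (auto simp: hom_def Pi_iff)
  moreover have "continuous_map T S \<Phi>"
    using \<Phi>(2) by (simp add: continuous_map_in_subtopology)
  then have "continuous_map T S (restrict \<Phi> (carrier G))"
    by (rule continuous_map_eq) (simp add: G.topspace_eq)
  ultimately show "\<exists>\<Phi>. \<Phi> \<in> hom G H \<inter> extensional (carrier G) \<and> continuous_map T S \<Phi> \<and>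
            (\<forall>x \<in> topspace X. \<Phi> (\<eta> x) = \<phi> x)"
    using \<Phi>(3) \<eta>G by (intro exI[of _ "restrict \<Phi> (carrier G)"]) auto

  fix \<Phi> \<Psi>
  assume \<Phi>: "\<Phi> \<in> hom G H \<inter> extensional (carrier G) \<and> continuous_map T S \<Phi> \<and>
            (\<forall>x \<in> topspace X. \<Phi> (\<eta> x) = \<phi> x)"
    and \<Psi>: "\<Psi> \<in> hom G H \<inter> extensional (carrier G) \<and> continuous_map T S \<Psi> \<and>
            (\<forall>x \<in> topspace X. \<Psi> (\<eta> x) = \<phi> x)"
  have cl: "\<Phi> g \<in> carrier H" "\<Psi> g \<in> carrier H" if "g \<in> carrier G" for g
    using \<Phi> \<Psi> that by (auto simp: hom_def)
  define \<Delta> where "\<Delta> g = \<Phi> g \<otimes>\<^bsub>H\<^esub> \<Psi> g" for g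
  have \<Delta>: "\<Delta> \<in> hom G H"
    using \<Phi> \<Psi> cl by (auto simp: hom_def \<Delta>_def H.m_ac)
  define E where "E = \<Delta> ` carrier G"
  have E: "subgroup E H"
    unfolding E_def using \<Delta>
    by (intro group_hom.img_is_subgroup)
      (simp add: group_hom_def group_hom_axioms_def G.is_group H.is_group)
  have "continuous_map T S ((\<lambda>(x, y). x \<otimes>\<^bsub>H\<^esub> y) \<circ> (\<lambda>g. (\<Phi> g, \<Psi> g)))"
    using \<Phi> \<Psi> by (intro continuous_map_compose[OF _ H.continuous_mult])
      (simp add: continuous_map_paired)
  then have "continuous_map T S \<Delta>"
    by (rule continuous_map_eq) (simp add: \<Delta>_def)
  then have c\<Delta>: "continuous_map T (subtopology S E) \<Delta>"
    by (rule continuous_map_into_subtopology) (auto simp: E_def G.topspace_eq)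
  have h\<Delta>: "\<Delta> \<in> hom G (H\<lparr>carrier := E\<rparr>)" using \<Delta> by (auto simp: hom_def E_def)
  have h1: "(\<lambda>_. \<one>\<^bsub>H\<^esub>) \<in> hom G (H\<lparr>carrier := E\<rparr>)"
    using subgroup.one_closed[OF E] by (auto simp: hom_def)
  have c1: "continuous_map T (subtopology S E) (\<lambda>_. \<one>\<^bsub>H\<^esub>)"
    using subgroup.one_closed[OF E] H.topspace_eq by simp
  have inj: "inj_on (\<lambda>d. Inr (inv_into (carrier G) \<Delta> d) :: 'x set + 'g) (carrier (H\<lparr>carrier := E\<rparr>))"
    unfolding E_def by (intro inj_onI) (rule inv_into_injective, auto)
  have ag: "\<Delta> (\<eta> x) = \<one>\<^bsub>H\<^esub>" if "x \<in> topspace X" for x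
    using that \<Phi> \<Psi> sq \<phi>H by (auto simp: \<Delta>_def)
  show "\<Phi> = \<Psi>"
  proof (rule extensionalityI[of _ "carrier G"])
    fix g assume g: "g \<in> carrier G"
    have "\<Delta> g = \<one>\<^bsub>H\<^esub>"
      using free_precompact_Boolean_group_unique_inj[OF free
          precompact_Boolean_group_subgroup[OF H E] inj h\<Delta> c\<Delta> h1 c1 ag g] .
    then have "inv\<^bsub>H\<^esub> (\<Psi> g) = \<Phi> g"
      using cl[OF g] by (intro H.inv_equality) (simp_all add: \<Delta>_def)
    then show "\<Phi> g = \<Psi> g" using cl[OF g] iv by simp
  qed (use \<Phi> \<Psi> in auto)
qed

end

theory Submission
  imports Defs
begin

text \<open>
  Every element of the free group is a finite sum of generators \<open>\<eta> x\<close>, \<open>x \<in> F\<close>; call \<open>F\<close> its support.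
  For clopen \<open>U\<close> the parity of \<open>F \<inter> U\<close> is a continuous character. If every subset of \<open>S\<close> is cut out
  by a clopen set on the supports of a compact set \<open>K\<close>, then these supports cover only finitely many
  points of \<open>S\<close>: otherwise there are elements \<open>k\<^sub>n\<close> of \<open>K\<close> whose supports each contain a new point
  \<open>s\<^sub>n\<close> of \<open>S\<close>, and each \<open>g\<close> in \<open>K\<close> is separated from almost all \<open>k\<^sub>n\<close> by the parity character of
  a suitable set of those \<open>s\<^sub>n\<close> that lie outside the support of \<open>g\<close>.

  An infinite set of isolated points of the sum contains an infinite \<open>S\<close> all of whose subsets are
  clopen: it either meets infinitely many summands, or splits within one summand into two infinite
  halves, one of which is not in the ultrafilter. So the supports of \<open>K\<close> contain only finitely many
  isolated points. On the summands without any of these points the supports contain at most the limit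
  points, and unions of whole summands cut out arbitrary sets of limit points. So the supports
  have a finite union, and \<open>K\<close> is finite.
\<close>

section \<open>Parity against sequences of finite supports, and compactness\<close>

lemma obtain_odd_trace:
  fixes F :: "nat \<Rightarrow> 'x set" and s :: "nat \<Rightarrow> 'x"
  assumes fin: "\<And>n. finite (F n)" and s: "\<And>n. s n \<in> F n" and new: "\<And>m n. m < n \<Longrightarrow> s n \<notin> F m"
  obtains A where "A \<subseteq> range s" "\<And>n. odd (card (F n \<inter> A))"
proof -
  \<comment> \<open>Whether \<open>s n\<close> joins the set \<open>A\<close> is decided recursively; later points do not affect \<open>F n\<close>.\<close>
  have "\<exists>b. \<forall>n. odd (card (F n \<inter> s ` {m. m < n \<and> b m}) + (if b n then 1 else 0))"
  proof (rule dependent_wellorder_choice)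
    fix r :: bool and f g :: "nat \<Rightarrow> bool" and n assume "\<And>m. m < n \<Longrightarrow> f m = g m"
    then have "{m. m < n \<and> f m} = {m. m < n \<and> g m}" by auto
    then show "odd (card (F n \<inter> s ` {m. m < n \<and> f m}) + (if r then 1 else 0)) =
        odd (card (F n \<inter> s ` {m. m < n \<and> g m}) + (if r then 1 else 0))"
      by (simp only:)
  next
    fix f :: "nat \<Rightarrow> bool" and n
    show "\<exists>r. odd (card (F n \<inter> s ` {m. m < n \<and> f m}) + (if r then 1 else 0))"
      by (rule exI[of _ "even (card (F n \<inter> s ` {m. m < n \<and> f m}))"]) auto
  qed
  then obtain b where b: "\<And>n. odd (card (F n \<inter> s ` {m. m < n \<and> b m}) + (if b n then 1 else 0))"
    by blast
  have "odd (card (F n \<inter> s ` {m. b m}))" for n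
  proof -
    \<comment> \<open>The point \<open>s n\<close> differs from all earlier ones, and all later ones
      lie outside \<open>F n\<close>; so beyond the earlier points the trace gains exactly
      \<open>s n\<close>, and only if \<open>b n\<close> holds.\<close>
    have "s n \<notin> s ` {m. m < n \<and> b m}" using s new by force
    moreover have "F n \<inter> s ` {m. b m} =
        F n \<inter> s ` {m. m < n \<and> b m} \<union> (if b n then {s n} else {})"
      using s[of n] new[of n] by (auto simp: image_iff) (metis linorder_neqE_nat)+
    ultimately show ?thesis using b[of n] fin[of n] by (auto split: if_splits)
  qed
  then show thesis using that[of "s ` {m. b m}"] by blast
qed

text \<open>The hypothesis \<open>cont\<close> is the form in which the parity characters enter: on
  \<open>K\<close>, evenness against any subset of \<open>S\<close> is an open condition. A sequence
  in \<open>K\<close> with ever new points of \<open>S\<close> in its supports would then have only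
  finitely many terms near each point of \<open>K\<close>.\<close>

lemma finite_Union_traces:
  fixes supp :: "'g \<Rightarrow> 'x set"
  assumes K: "compactin T K" and fin: "\<And>k. k \<in> K \<Longrightarrow> finite (supp k)"
    and cont: "\<And>A. A \<subseteq> S \<Longrightarrow> \<exists>W. openin T W \<and> K \<inter> W = {k \<in> K. even (card (supp k \<inter> A))}"
  shows "finite (S \<inter> (\<Union>k\<in>K. supp k))"
proof (rule ccontr)
  assume inf: "infinite (S \<inter> (\<Union>k\<in>K. supp k))"
  \<comment> \<open>Each \<open>p n\<close> pairs an element of \<open>K\<close> with a point of its
    support in \<open>S\<close> that no earlier support contains.\<close>
  have "\<exists>p. \<forall>n::nat. fst (p n) \<in> K \<and>
      snd (p n) \<in> supp (fst (p n)) \<inter> S - (\<Union>m<n. supp (fst (p m)))"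
  proof (rule dependent_wellorder_choice)
    fix n :: nat and p :: "nat \<Rightarrow> 'g \<times> 'x"
    assume "\<And>m. m < n \<Longrightarrow> fst (p m) \<in> K \<and>
      snd (p m) \<in> supp (fst (p m)) \<inter> S - (\<Union>l<m. supp (fst (p l)))"
    then have "finite (\<Union>m<n. supp (fst (p m)))" using fin by blast
    then have "infinite (S \<inter> (\<Union>k\<in>K. supp k) - (\<Union>m<n. supp (fst (p m))))"
      using inf by simp
    then obtain x where "x \<in> S \<inter> (\<Union>k\<in>K. supp k) - (\<Union>m<n. supp (fst (p m)))"
      using infinite_imp_nonempty by blast
    then show "\<exists>r. fst r \<in> K \<and> snd r \<in> supp (fst r) \<inter> S - (\<Union>m<n. supp (fst (p m)))"
      by auto
  qed auto
  then obtain p where p: "\<And>n::nat. fst (p n) \<in> K \<and>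
      snd (p n) \<in> supp (fst (p n)) \<inter> S - (\<Union>m<n. supp (fst (p m)))" by blast
  define k s where "k n = fst (p n)" and "s n = snd (p n)" for n
  have k: "k n \<in> K" and s: "s n \<in> supp (k n)" "s n \<in> S" and new: "m < n \<Longrightarrow> s n \<notin> supp (k m)" for m n
    using p[of n] by (auto simp: k_def s_def)
  have injs: "inj s"
    using s(1) new by (intro linorder_injI) metis
  \<comment> \<open>With such neighbourhoods a finite subcover of \<open>K\<close> would account for
    only finitely many of the indices \<open>n\<close>.\<close>
  have "\<exists>W. openin T W \<and> g \<in> W \<and> finite {n. k n \<in> W}" if g: "g \<in> K" for g
  proof -
    have "finite (s -` supp g)" using fin[OF g] injs by (rule finite_vimageI)
    then obtain N where N: "\<And>n. n \<ge> N \<Longrightarrow> s n \<notin> supp g"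
      by (metis finite_nat_set_iff_bounded linorder_not_less vimageI)
    \<comment> \<open>The shift by \<open>N\<close> keeps \<open>A\<close> disjoint from
      \<open>supp g\<close>: the parity of \<open>g\<close> against \<open>A\<close> is even, that
      of every \<open>k n\<close> with n \<ge> N is odd.\<close>
    obtain A where A: "A \<subseteq> range (\<lambda>n. s (n + N))" "\<And>n. odd (card (supp (k (n + N)) \<inter> A))"
      using fin k s new obtain_odd_trace[of "\<lambda>n. supp (k (n + N))" "\<lambda>n. s (n + N)"]
      by (metis add_less_cancel_right)
    have "A \<subseteq> S" using A(1) s by blast
    then obtain W where W: "openin T W" "K \<inter> W = {k \<in> K. even (card (supp k \<inter> A))}"
      using cont by blast
    have "supp g \<inter> A = {}" using A(1) N by auto
    then have "g \<in> W" using g W(2) by auto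
    moreover have "{n. k n \<in> W} \<subseteq> {..<N}"
    proof (rule subsetI, rule ccontr)
      fix n assume n: "n \<in> {n. k n \<in> W}" "n \<notin> {..<N}"
      then have "odd (card (supp (k n) \<inter> A))" using A(2)[of "n - N"] by simp
      then show False using n(1) k[of n] W(2) by blast
    qed
    ultimately show ?thesis using W(1) finite_subset by blast
  qed
  then obtain W where W: "\<And>g. g \<in> K \<Longrightarrow> openin T (W g) \<and> g \<in> W g \<and> finite {n. k n \<in> W g}"
    by metis
  then have "\<And>V. V \<in> W ` K \<Longrightarrow> openin T V" "K \<subseteq> \<Union>(W ` K)" by auto
  then obtain \<F> where \<F>: "finite \<F>" "\<F> \<subseteq> W ` K" "K \<subseteq> \<Union>\<F>"
    using compactinD[OF K] by meson
  have "(UNIV :: nat set) \<subseteq> (\<Union>V\<in>\<F>. {n. k n \<in> V})"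
  proof
    fix n
    obtain V where "V \<in> \<F>" "k n \<in> V" using subsetD[OF \<F>(3) k[of n]] by (rule UnionE)
    then show "n \<in> (\<Union>V\<in>\<F>. {n. k n \<in> V})" by blast
  qed
  moreover have "finite (\<Union>V\<in>\<F>. {n. k n \<in> V})"
  proof (rule finite_UN_I[OF \<F>(1)])
    fix V assume "V \<in> \<F>"
    then obtain g where "g \<in> K" "V = W g" using \<F>(2) by auto
    then show "finite {n. k n \<in> V}" using W by simp
  qed
  ultimately show False using infinite_UNIV_nat finite_subset by metis
qed

section \<open>Finite supports and parity characters in the free group\<close>

text \<open>The finite sums of generators form a subgroup \<open>D\<close>, again precompact
  Boolean. So \<open>\<eta>\<close> extends to a homomorphism into \<open>D\<close>, which agrees
  with the identity on the generators and hence everywhere, by uniqueness; thus \<open>D\<close> is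
  the whole group. Sets of generators suffice because repeated ones cancel.\<close>

lemma free_precompact_Boolean_group_ex_finprod:
  fixes X :: "'x topology" and G :: "'g monoid" (structure)
  assumes free: "free_precompact_Boolean_group X G T \<eta>" and g: "g \<in> carrier G"
  obtains F where "finite F" "F \<subseteq> topspace X" "g = finprod G \<eta> F"
proof -
  have G: "precompact_Boolean_group G T" and \<eta>: "continuous_map X T \<eta>"
    using free by (auto simp: free_precompact_Boolean_group_def)
  interpret topological_group G T using G by (rule precompact_Boolean_groupD)
  interpret comm_group G using G by (rule precompact_Boolean_groupD)
  have \<eta>G: "\<eta> \<in> topspace X \<rightarrow> carrier G"
    using \<eta> topspace_eq by (auto simp: continuous_map_def)
  define Fin where "Fin = {F. finite F \<and> F \<subseteq> topspace X}"
  define D where "D = finprod G \<eta> ` Fin"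
  have clo: "finprod G \<eta> F \<in> carrier G" if "F \<in> Fin" for F
    using that \<eta>G by (intro finprod_closed) (auto simp: Fin_def)
  have ins: "finprod G \<eta> (insert x F) = \<eta> x \<otimes> finprod G \<eta> F"
    if "F \<in> Fin" "x \<in> topspace X" "x \<notin> F" for F x
    using that \<eta>G by (intro finprod_insert) (auto simp: Fin_def)
  \<comment> \<open>A generator already in \<open>F\<close> cancels; a new one is inserted.\<close>
  have add1: "finprod G \<eta> F \<otimes> \<eta> x \<in> D" if "F \<in> Fin" "x \<in> topspace X" for F x
  proof (cases "x \<in> F")
    case True
    define F' where "F' = F - {x}"
    have F': "F' \<in> Fin" "F = insert x F'" "x \<notin> F'" using that True by (auto simp: F'_def Fin_def)
    then have "finprod G \<eta> F = \<eta> x \<otimes> finprod G \<eta> F'"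
      using ins that(2) by simp
    moreover have "\<eta> x \<in> carrier G" using that \<eta>G by auto
    ultimately have "finprod G \<eta> F \<otimes> \<eta> x = finprod G \<eta> F' \<otimes> (\<eta> x \<otimes> \<eta> x)"
      using clo[OF F'(1)] m_comm[of "\<eta> x" "finprod G \<eta> F'"] by (simp add: m_assoc)
    then have "finprod G \<eta> F \<otimes> \<eta> x = finprod G \<eta> F'"
      using clo[OF F'(1)] \<open>\<eta> x \<in> carrier G\<close> precompact_Boolean_groupD(3)[OF G] by simp
    then show ?thesis using F' by (auto simp: D_def)
  next
    case False
    moreover have "\<eta> x \<in> carrier G" using that \<eta>G by auto
    ultimately have "finprod G \<eta> F \<otimes> \<eta> x = finprod G \<eta> (insert x F)"
      using ins[OF that] clo[OF that(1)] m_comm by simp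
    then show ?thesis using that by (auto simp: D_def Fin_def)
  qed
  \<comment> \<open>The points of \<open>F'\<close> are moved over to \<open>F\<close> one at a
    time, so \<open>F\<close> has to vary in the induction.\<close>
  have add: "finprod G \<eta> F \<otimes> finprod G \<eta> F' \<in> D" if "finite F'" "F' \<subseteq> topspace X" "F \<in> Fin" for F F'
    using that
  proof (induction arbitrary: F rule: finite_induct)
    case empty
    then show ?case using clo by (auto simp: D_def)
  next
    case (insert x F')
    then obtain F'' where F'': "F'' \<in> Fin" "finprod G \<eta> F \<otimes> \<eta> x = finprod G \<eta> F''"
      using add1[of F x] unfolding D_def by blast
    have cl: "\<eta> x \<in> carrier G" "finprod G \<eta> F \<in> carrier G" "finprod G \<eta> F' \<in> carrier G"
      using insert.prems insert.hyps \<eta>G clo by (auto simp: Fin_def)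
    have "finprod G \<eta> (insert x F') = \<eta> x \<otimes> finprod G \<eta> F'"
      using insert.prems insert.hyps by (intro ins) (auto simp: Fin_def)
    then have "finprod G \<eta> F \<otimes> finprod G \<eta> (insert x F') = finprod G \<eta> F'' \<otimes> finprod G \<eta> F'"
      using cl F''(2) by (simp add: m_assoc[symmetric])
    then show ?case using insert F''(1) by simp
  qed
  have D: "subgroup D G"
  proof (rule subgroupI)
    show "D \<subseteq> carrier G" using clo by (auto simp: D_def)
    show "D \<noteq> {}" by (auto simp: D_def Fin_def)
    show "inv a \<in> D" if "a \<in> D" for a
      using that precompact_Boolean_groupD(4)[OF G] clo by (auto simp: D_def)
    show "a \<otimes> b \<in> D" if "a \<in> D" "b \<in> D" for a b
      using that add by (auto simp: D_def Fin_def)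
  qed
  have \<eta>D: "\<eta> x \<in> D" if "x \<in> topspace X" for x
  proof -
    have "\<eta> x \<in> carrier G" using that \<eta>G by auto
    then show ?thesis using add1[of "{}" x] that by (simp add: Fin_def)
  qed
  then have "continuous_map X (subtopology T D) \<eta>"
    using \<eta> by (auto intro: continuous_map_into_subtopology)
  \<comment> \<open>\<open>Inr\<close> places the elements of \<open>D\<close> in the type of the
    test groups.\<close>
  then obtain \<Phi> where \<Phi>: "\<Phi> \<in> hom G (G\<lparr>carrier := D\<rparr>)"
    "continuous_map T (subtopology T D) \<Phi>" "\<And>x. x \<in> topspace X \<Longrightarrow> \<Phi> (\<eta> x) = \<eta> x"
    using free_precompact_Boolean_group_ex_inj[OF free precompact_Boolean_group_subgroup[OF G D], of Inr \<eta>]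
    by (auto simp: inj_on_def)
  have "\<Phi> \<in> hom G G" using \<Phi>(1) subgroup.subset[OF D] by (auto simp: hom_def Pi_iff)
  moreover have "continuous_map T T \<Phi>" using \<Phi>(2) by (simp add: continuous_map_in_subtopology)
  moreover have "id \<in> hom G G" by (simp add: hom_def)
  moreover have "inj_on Inr (carrier G)" by simp
  ultimately have "\<Phi> g = id g"
    using \<Phi>(3) g free_precompact_Boolean_group_unique_inj[OF free G, of Inr \<Phi> id g] by simp
  moreover have "\<Phi> g \<in> D" using \<Phi>(1) g by (auto simp: hom_def)
  ultimately show thesis using that by (auto simp: D_def Fin_def)
qed

text \<open>The indicator of a clopen set is a continuous map to the group of two elements. Its
  extension to the free group counts, modulo 2, the generators of a sum that lie in
  \<open>U\<close>; \<open>W\<close> is the kernel.\<close>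

lemma free_precompact_Boolean_group_parity:
  fixes X :: "'x topology" and G :: "'g monoid" (structure)
  assumes free: "free_precompact_Boolean_group X G T \<eta>" and U: "openin X U" "closedin X U"
  shows "\<exists>W. openin T W \<and>
    (\<forall>F. finite F \<longrightarrow> F \<subseteq> topspace X \<longrightarrow> (finprod G \<eta> F \<in> W \<longleftrightarrow> even (card (F \<inter> U))))"
proof -
  have G: "precompact_Boolean_group G T" and \<eta>: "continuous_map X T \<eta>"
    using free by (auto simp: free_precompact_Boolean_group_def)
  interpret topological_group G T using G by (rule precompact_Boolean_groupD)
  interpret comm_group G using G by (rule precompact_Boolean_groupD)
  have \<eta>G: "\<eta> \<in> topspace X \<rightarrow> carrier G"
    using \<eta> topspace_eq by (auto simp: continuous_map_def)
  \<comment> \<open>Exclusive or makes \<open>bool\<close> the group of two elements. Being finite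
    and discrete it is compact, so \<open>id\<close> witnesses precompactness.\<close>
  define H where "H = (\<lparr>carrier = UNIV, mult = (\<noteq>), one = False\<rparr> :: bool monoid)"
  define S where "S = discrete_topology (UNIV :: bool set)"
  have grp: "group H" by (rule groupI) (auto simp: H_def)
  have top: "topological_group H S"
    using grp by (intro topological_group.intro topological_group_axioms.intro)
      (auto simp: S_def H_def prod_topology_discrete_topology[symmetric])
  have "precompact_group H S"
    by (rule precompact_groupI[OF top top, where h = id])
      (auto simp: S_def hom_def compact_space_discrete_topology
        intro: homeomorphic_map_imp_embedding_map)
  then have "precompact_Boolean_group H S"
    by (simp add: precompact_Boolean_group_def H_def)
  moreover have "continuous_map X S (\<lambda>x. x \<in> U)"
    unfolding continuous_map
  proof (intro conjI allI impI)
    fix V assume "openin S V"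
    have "{x \<in> topspace X. (x \<in> U) \<in> V} =
        (if True \<in> V then U else {}) \<union> (if False \<in> V then topspace X - U else {})"
      using openin_subset[OF U(1)] by (auto split: if_splits) (metis (full_types))+
    then show "openin X {x \<in> topspace X. (x \<in> U) \<in> V}"
      using U by (auto simp: closedin_def)
  qed (auto simp: S_def)
  ultimately obtain \<Phi> where \<Phi>: "\<Phi> \<in> hom G H" "continuous_map T S \<Phi>"
    "\<And>x. x \<in> topspace X \<Longrightarrow> \<Phi> (\<eta> x) \<longleftrightarrow> x \<in> U"
    using free_precompact_Boolean_group_universal[OF free] by (metis IntD1)
  have "\<Phi> (finprod G \<eta> F) \<longleftrightarrow> odd (card (F \<inter> U))" if "finite F" "F \<subseteq> topspace X" for F
    using that
  proof (induction rule: finite_induct)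
    case empty
    then show ?case using hom_one[OF \<Phi>(1)] grp is_group by (simp add: H_def)
  next
    case (insert x F)
    have "finprod G \<eta> (insert x F) = \<eta> x \<otimes> finprod G \<eta> F"
      using insert.prems insert.hyps \<eta>G by (intro finprod_insert) auto
    moreover have "\<eta> x \<in> carrier G" "finprod G \<eta> F \<in> carrier G"
      using insert.prems \<eta>G by (auto intro!: finprod_closed)
    ultimately have "\<Phi> (finprod G \<eta> (insert x F)) \<longleftrightarrow> \<Phi> (\<eta> x) \<noteq> \<Phi> (finprod G \<eta> F)"
      using hom_mult[OF \<Phi>(1)] by (simp add: H_def)
    then show ?case using insert \<Phi>(3) by auto
  qed
  moreover have "openin T {g \<in> topspace T. \<Phi> g \<in> {False}}"
    using \<Phi>(2) by (rule openin_continuous_map_preimage) (simp add: S_def)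
  moreover have "finprod G \<eta> F \<in> topspace T" if "F \<subseteq> topspace X" for F
    using that \<eta>G unfolding topspace_eq by (intro finprod_closed) auto
  ultimately show ?thesis
    by (intro exI[of _ "{g \<in> topspace T. \<Phi> g \<in> {False}}"]) auto
qed

section \<open>Clopen sets in elementary spaces and their sums\<close>

text \<open>Here \<open>x\<close> is the non-isolated point. A set of isolated points is always
  open, and it is closed once its complement is a neighbourhood of \<open>x\<close>, a property
  inherited by subsets. Of two disjoint sets the ultrafilter contains at most one.\<close>

lemma elementary_space_limit_point:
  assumes "elementary_space X"
  shows "\<exists>x. (\<forall>y \<in> topspace X - {x}. openin X {y} \<and> closedin X {y}) \<and>
    (\<forall>A. infinite A \<longrightarrow> A \<subseteq> topspace X - {x} \<longrightarrow>
      (\<exists>S\<subseteq>A. infinite S \<and> (\<forall>S'\<subseteq>S. openin X S' \<and> closedin X S')))"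
proof -
  obtain x where haus: "Hausdorff_space X" and x: "x \<in> topspace X"
    and iso: "\<And>y. y \<in> topspace X - {x} \<Longrightarrow> openin X {y}" and uf: "ultrafilter (atin X x)"
    using assms unfolding elementary_space_iff by blast
  have op: "openin X S" if "S \<subseteq> topspace X - {x}" for S
    using iso that by (subst openin_subopen) blast
  have clopen: "openin X S \<and> closedin X S"
    if S: "S \<subseteq> topspace X - {x}" "eventually (\<lambda>y. y \<notin> S) (atin X x)" for S
  proof -
    obtain V where V: "openin X V" "x \<in> V" "\<forall>y \<in> V - {x}. y \<notin> S"
      using S(2) x by (auto simp: eventually_atin)
    have "topspace X - S = V \<union> (topspace X - {x} - S)"
      using V S(1) openin_subset[OF V(1)] by blast
    moreover have "openin X \<dots>" using V(1) op[of "topspace X - {x} - S"] by blast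
    ultimately show ?thesis using op[OF S(1)] S(1) by (auto simp: closedin_def)
  qed
  have pt: "openin X {y} \<and> closedin X {y}" if "y \<in> topspace X - {x}" for y
    using iso[OF that] that haus by (simp add: closedin_Hausdorff_singleton)
  have discrete: "\<exists>S\<subseteq>A. infinite S \<and> (\<forall>S'\<subseteq>S. openin X S' \<and> closedin X S')"
    if A: "infinite A" "A \<subseteq> topspace X - {x}" for A
  proof -
    obtain B C where BC: "B \<subseteq> A" "C \<subseteq> A" "infinite B" "infinite C" "B \<inter> C = {}"
      using infinite_split[OF A(1)] .
    \<comment> \<open>If the first alternative fails, the ultrafilter contains \<open>B\<close> and
      therefore the complement of the disjoint set \<open>C\<close>.\<close>
    have "eventually (\<lambda>y. y \<notin> B) (atin X x) \<or> eventually (\<lambda>y. y \<notin> C) (atin X x)"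
      using uf BC(5) unfolding ultrafilter_def
      by (metis (mono_tags, lifting) disjoint_iff eventually_mono)
    then obtain S where S: "S \<subseteq> A" "infinite S" "eventually (\<lambda>y. y \<notin> S) (atin X x)"
      using BC by blast
    have "openin X S' \<and> closedin X S'" if "S' \<subseteq> S" for S'
      using that S A(2) by (intro clopen) (auto elim!: eventually_mono)
    then show ?thesis using S by blast
  qed
  show ?thesis
  proof (rule exI[of _ x], rule conjI)
    show "\<forall>y \<in> topspace X - {x}. openin X {y} \<and> closedin X {y}" using pt by (rule ballI)
    show "\<forall>A. infinite A \<longrightarrow> A \<subseteq> topspace X - {x} \<longrightarrow>
      (\<exists>S\<subseteq>A. infinite S \<and> (\<forall>S'\<subseteq>S. openin X S' \<and> closedin X S'))"
      using discrete by (intro allI impI)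
  qed
qed

text \<open>Clopenness in a sum is tested on each summand. If \<open>A\<close> meets finitely many
  summands, one of them contains infinitely many of its points and \<open>sub\<close> applies there;
  otherwise one point from each summand met will do, by \<open>pt\<close>.\<close>

lemma sum_topology_discrete_subset:
  assumes pt: "\<And>i y. i \<in> I \<Longrightarrow> y \<in> D i \<Longrightarrow> openin (E i) {y} \<and> closedin (E i) {y}"
    and sub: "\<And>i A. i \<in> I \<Longrightarrow> infinite A \<Longrightarrow> A \<subseteq> D i \<Longrightarrow>
      \<exists>S\<subseteq>A. infinite S \<and> (\<forall>S'\<subseteq>S. openin (E i) S' \<and> closedin (E i) S')"
    and A: "infinite A" "A \<subseteq> Sigma I D"
  shows "\<exists>S\<subseteq>A. infinite S \<and>
    (\<forall>S'\<subseteq>S. openin (sum_topology E I) S' \<and> closedin (sum_topology E I) S')"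
proof -
  have clopen: "openin (sum_topology E I) S \<and> closedin (sum_topology E I) S"
    if "S \<subseteq> Sigma I D" "\<And>i. i \<in> I \<Longrightarrow> openin (E i) {y. (i, y) \<in> S} \<and> closedin (E i) {y. (i, y) \<in> S}"
    for S
  proof -
    have "S \<subseteq> Sigma I (topspace \<circ> E)"
    proof (rule subrelI)
      fix i y assume "(i, y) \<in> S"
      then have "i \<in> I" "y \<in> D i" using that(1) by auto
      then show "(i, y) \<in> Sigma I (topspace \<circ> E)" using pt[of i y] openin_subset[of "E i" "{y}"] by simp
    qed
    then show ?thesis using that(2) by (simp add: openin_sum_topology closedin_sum_topology)
  qed
  show ?thesis
  proof (cases "finite (fst ` A)")
    case True
    \<comment> \<open>Pigeonhole: a finite union of finite slices would be finite.\<close>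
    have "A \<subseteq> (\<Union>i\<in>fst ` A. Pair i ` {y. (i, y) \<in> A})" by force
    then obtain i where i: "i \<in> fst ` A" "infinite {y. (i, y) \<in> A}"
      using A(1) True by (meson finite_UN_I finite_imageI finite_subset)
    moreover have "i \<in> I" "{y. (i, y) \<in> A} \<subseteq> D i" using i(1) A(2) by auto
    ultimately obtain S where S: "S \<subseteq> {y. (i, y) \<in> A}" "infinite S"
      "\<And>S'. S' \<subseteq> S \<Longrightarrow> openin (E i) S' \<and> closedin (E i) S'"
      using sub by metis
    show ?thesis
    proof (intro exI[of _ "Pair i ` S"] conjI[OF _ conjI] allI impI)
      show "infinite (Pair i ` S)" using S(2) by (simp add: finite_image_iff inj_on_def)
      fix S' assume S': "S' \<subseteq> Pair i ` S"
      show "openin (sum_topology E I) S' \<and> closedin (sum_topology E I) S'"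
      proof (rule clopen)
        fix j
        show "openin (E j) {y. (j, y) \<in> S'} \<and> closedin (E j) {y. (j, y) \<in> S'}"
        proof (cases "j = i")
          case True
          then show ?thesis using S(3)[of "{y. (j, y) \<in> S'}"] S' by blast
        next
          case False
          then have "{y. (j, y) \<in> S'} = {}" using S' by auto
          then show ?thesis by simp
        qed
      qed (use S' S(1) A(2) in auto)
    qed (use S in auto)
  next
    case False
    define c where "c i = (SOME y. (i, y) \<in> A)" for i
    have c: "(i, c i) \<in> A" if "i \<in> fst ` A" for i
      using that unfolding c_def by (auto intro: someI)
    define S where "S = (\<lambda>i. (i, c i)) ` fst ` A"
    show ?thesis
    proof (intro exI[of _ S] conjI[OF _ conjI] allI impI)
      show "S \<subseteq> A" using c by (auto simp: S_def)
      show "infinite S" unfolding S_def using False by (simp add: finite_image_iff inj_on_def)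
      fix S' assume S': "S' \<subseteq> S"
      show "openin (sum_topology E I) S' \<and> closedin (sum_topology E I) S'"
      proof (rule clopen)
        fix i assume i: "i \<in> I"
        \<comment> \<open>Every slice has at most one point, and that point is clopen in its
          summand.\<close>
        have "{y. (i, y) \<in> S'} = {} \<or> ({y. (i, y) \<in> S'} = {c i} \<and> (i, c i) \<in> A)"
          using S' c by (auto simp: S_def)
        then show "openin (E i) {y. (i, y) \<in> S'} \<and> closedin (E i) {y. (i, y) \<in> S'}"
          using pt[OF i, of "c i"] A(2) by auto
      qed (use S' \<open>S \<subseteq> A\<close> A(2) in auto)
    qed
  qed
qed

section \<open>Finiteness of the union of the supports\<close>

theorem corollary4p3:
  fixes E :: "'i \<Rightarrow> 'a topology" and I :: "'i set"
    and G :: "'g monoid" and T :: "'g topology" and \<eta> :: "'i \<times> 'a \<Rightarrow> 'g"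
  assumes "\<And>i. i \<in> I \<Longrightarrow> elementary_space (E i)"
    and "free_precompact_Boolean_group (sum_topology E I) G T \<eta>"
  shows "\<not> (\<exists>K. compactin T K \<and> infinite K)"
proof
  assume "\<exists>K. compactin T K \<and> infinite K"
  then obtain K where K: "compactin T K" "infinite K" by blast
  let ?X = "sum_topology E I"
  note free = assms(2)
  have "topspace T = carrier G"
    using free precompact_Boolean_groupD(5) unfolding free_precompact_Boolean_group_def by blast
  then have KG: "K \<subseteq> carrier G" using compactin_subset_topspace[OF K(1)] by simp
  have "\<exists>F. finite F \<and> F \<subseteq> topspace ?X \<and> finprod G \<eta> F = g" if "g \<in> K" for g
    using free_precompact_Boolean_group_ex_finprod[OF free, of g] KG that by blast
  then have "\<forall>g \<in> K. \<exists>F. finite F \<and> F \<subseteq> topspace ?X \<and> finprod G \<eta> F = g" by blast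
  from bchoice[OF this] obtain supp where *:
    "\<forall>g \<in> K. finite (supp g) \<and> supp g \<subseteq> topspace ?X \<and> finprod G \<eta> (supp g) = g" ..
  then have supp: "finite (supp g)" "supp g \<subseteq> topspace ?X" "finprod G \<eta> (supp g) = g"
    if "g \<in> K" for g using bspec[OF * that] by simp_all
  define U where "U = (\<Union>g\<in>K. supp g)"
  \<comment> \<open>The clopen set only has to agree with \<open>A\<close> on \<open>U\<close>,
    since parities are taken on supports inside \<open>U\<close>.\<close>
  have traces: "finite (S \<inter> U)"
    if V: "\<And>A. A \<subseteq> S \<Longrightarrow> \<exists>V. openin ?X V \<and> closedin ?X V \<and> U \<inter> V = U \<inter> A" for S
    unfolding U_def
  proof (rule finite_Union_traces[where supp = supp, OF K(1)])
    show "finite (supp g)" if "g \<in> K" for g using that by (rule supp(1))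
    fix A assume "A \<subseteq> S"
    then obtain V where V: "openin ?X V" "closedin ?X V" "U \<inter> V = U \<inter> A" using V[of A] by blast
    obtain W where W: "openin T W" "\<And>F. finite F \<Longrightarrow> F \<subseteq> topspace ?X \<Longrightarrow>
        finprod G \<eta> F \<in> W \<longleftrightarrow> even (card (F \<inter> V))"
      using free_precompact_Boolean_group_parity[OF free V(1,2)] by blast
    have "g \<in> W \<longleftrightarrow> even (card (supp g \<inter> A))" if "g \<in> K" for g
    proof -
      have "supp g \<inter> V = supp g \<inter> A" using V(3) that by (auto simp: U_def)
      then show ?thesis using W(2)[of "supp g"] supp[OF that] by simp
    qed
    then show "\<exists>W. openin T W \<and> K \<inter> W = {k \<in> K. even (card (supp k \<inter> A))}"
      using W(1) by blast
  qed
  have "\<forall>i \<in> I. \<exists>x.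
    (\<forall>y \<in> topspace (E i) - {x}. openin (E i) {y} \<and> closedin (E i) {y}) \<and>
    (\<forall>A. infinite A \<longrightarrow> A \<subseteq> topspace (E i) - {x} \<longrightarrow>
      (\<exists>S\<subseteq>A. infinite S \<and> (\<forall>S'\<subseteq>S. openin (E i) S' \<and> closedin (E i) S')))"
    using assms(1) by (intro ballI elementary_space_limit_point)
  from bchoice[OF this] obtain x where *: "\<forall>i \<in> I.
    (\<forall>y \<in> topspace (E i) - {x i}. openin (E i) {y} \<and> closedin (E i) {y}) \<and>
    (\<forall>A. infinite A \<longrightarrow> A \<subseteq> topspace (E i) - {x i} \<longrightarrow>
      (\<exists>S\<subseteq>A. infinite S \<and> (\<forall>S'\<subseteq>S. openin (E i) S' \<and> closedin (E i) S')))" ..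
  have x: "openin (E i) {y} \<and> closedin (E i) {y}" if "i \<in> I" "y \<in> topspace (E i) - {x i}" for i y
    by (rule bspec[OF bspec[OF * that(1), THEN conjunct1] that(2)])
  have x': "\<exists>S\<subseteq>A. infinite S \<and> (\<forall>S'\<subseteq>S. openin (E i) S' \<and> closedin (E i) S')"
    if "i \<in> I" "infinite A" "A \<subseteq> topspace (E i) - {x i}" for i A
    by (rule bspec[OF * that(1), THEN conjunct2, THEN spec, THEN mp, THEN mp, OF that(2,3)])
  \<comment> \<open>The isolated points of the sum.\<close>
  define D where "D = (SIGMA i:I. topspace (E i) - {x i})"
  have finD: "finite (U \<inter> D)"
  proof (rule ccontr)
    assume "infinite (U \<inter> D)"
    moreover have "U \<inter> D \<subseteq> (SIGMA i:I. topspace (E i) - {x i})" by (auto simp: D_def)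
    ultimately have "\<exists>S\<subseteq>U \<inter> D. infinite S \<and> (\<forall>S'\<subseteq>S. openin ?X S' \<and> closedin ?X S')"
      by (rule sum_topology_discrete_subset[rotated 2]) (fact x x')+
    then obtain S where S: "S \<subseteq> U \<inter> D" "infinite S"
      "\<And>S'. S' \<subseteq> S \<Longrightarrow> openin ?X S' \<and> closedin ?X S'" by blast
    have "finite (S \<inter> U)" using S(3) by (intro traces) blast
    moreover have "S \<inter> U = S" using S(1) by blast
    ultimately show False using S(2) by simp
  qed
  \<comment> \<open>\<open>J\<close> indexes the finitely many summands with an isolated point in
    \<open>U\<close>; \<open>L\<close> collects the limit points of all other summands, each of
    which meets \<open>U\<close> at most in its limit point.\<close>
  define J where "J = fst ` (U \<inter> D)"
  define L where "L = (\<lambda>i. (i, x i)) ` (I - J)"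
  have UX: "U \<subseteq> topspace ?X" using supp(2) by (auto simp: U_def)
  have "finite (L \<inter> U)"
  proof (rule traces)
    fix A assume A: "A \<subseteq> L"
    have eq: "{y. (i, y) \<in> Sigma (fst ` A) (topspace \<circ> E)} = (if i \<in> fst ` A then topspace (E i) else {})" for i
      by auto
    have "fst ` A \<subseteq> I" using A by (auto simp: L_def)
    then have "openin ?X (Sigma (fst ` A) (topspace \<circ> E)) \<and> closedin ?X (Sigma (fst ` A) (topspace \<circ> E))"
      unfolding openin_sum_topology closedin_sum_topology eq by auto
    \<comment> \<open>The set \<open>A\<close> of limit points is itself not open unless empty, but
      the union of its whole summands is clopen and has the same trace on \<open>U\<close>.\<close>
    moreover have "U \<inter> Sigma (fst ` A) (topspace \<circ> E) = U \<inter> A"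
    proof -
      have "y = x i" if "(i, y) \<in> U" "i \<in> fst ` A" for i y
      proof (rule ccontr)
        assume "y \<noteq> x i"
        then have "(i, y) \<in> U \<inter> D" using that(1) UX by (auto simp: D_def)
        then have "i \<in> J" unfolding J_def by force
        then show False using that(2) A by (auto simp: L_def)
      qed
      moreover have "(i, x i) \<in> A" if "i \<in> fst ` A" for i using A that by (auto simp: L_def)
      ultimately have inA: "z \<in> A" if "z \<in> U" "fst z \<in> fst ` A" for z
        using that by (metis prod.collapse)
      have "z \<in> Sigma (fst ` A) (topspace \<circ> E) \<longleftrightarrow> z \<in> A" if "z \<in> U" for z
        using subsetD[OF UX that] inA[OF that] imageI[of z A fst] by (cases z) auto
      then show ?thesis by blast
    qed
    ultimately show "\<exists>V. openin ?X V \<and> closedin ?X V \<and> U \<inter> V = U \<inter> A" by blast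
  qed
  \<comment> \<open>A point of \<open>U\<close> is isolated, or the limit point of a summand with
    index in \<open>J\<close>, or one with index outside \<open>J\<close>.\<close>
  moreover have "U \<subseteq> (U \<inter> D) \<union> (\<lambda>i. (i, x i)) ` J \<union> (L \<inter> U)"
    using UX by (auto simp: D_def L_def)
  moreover have "finite J" using finD by (simp add: J_def)
  ultimately have "finite U" using finD by (meson finite_UnI finite_imageI finite_subset)
  \<comment> \<open>Each element of \<open>K\<close> is the sum over its support, and a finite
    \<open>U\<close> has only finitely many subsets.\<close>
  moreover have "K \<subseteq> finprod G \<eta> ` Pow U"
  proof
    fix g assume "g \<in> K"
    then show "g \<in> finprod G \<eta> ` Pow U"
      by (intro image_eqI[of _ _ "supp g"]) (auto simp: supp U_def)
  qed
  ultimately show False using K(2) finite_subset by blast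
qed

end
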